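(* Let $k$ be a field. Let $$S=\{Q_{k<K}(W): k<K\text{ is a quadratic field extension},\ W\text{ is a }k\text{-subspace of }K,\ \dim_k(W)=1,\ k\cap W=0\},$$ $$T=\{Q_k(A): A\in M_2(k),\ kI+kA\text{ is an anisotropic plane}\}.$$ Then, up to isomorphism, the loops of $S$ are precisely the loops of $T$; that is, every loop in $S$ is isomorphic to some loop in $T$ and every loop in $T$ is isomorphic to some loop in $S$.
   Context: For a field extension $k<K$ and a $k$-subspace $W$ of $K$ with $k\cap W=0$, $Q_{k<K}(W)$ is the loop on the set $W\times K$ with multiplication $(a,u)(b,v)=(a+b,\;u(1+b)+v(1-a))$, where all operations on the right are those of $K$. $M_2(k)$ is the space of $2\times 2$ matrices over $k$ and $I$ is the identity matrix. For $A\in M_2(k)$, $kI+kA$ is an anisotropic plane if $\det(aI+bA)\ne 0$ for every $(a,b)\in k\times k$ with $(a,b)\neq(0,0)$. For such $A$, $Q_k(A)$ is the loop on the set $k\times(k\times k)$ with multiplication $(a,u)(b,v)=(a+b,\;u(I+bA)+v(I-aA))$, where elements of $k\times k$ are row vectors on which matrices act from the right. *)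

theory Defs
  imports
    "HOL-Algebra.Embedded_Algebras"
    "HOL-Algebra.Algebraic_Closure_Type"
    "HOL-Analysis.Determinants"
begin

text \<open>
  The base field k is a type of class \<open>field\<close>; the extension K is a \<open>HOL-Algebra\<close> field with an
  embedding \<open>h\<close> of k, so that one can quantify over K inside a statement. Inside K, the field k is
  the image \<open>range h\<close>.
  Loops are represented as \<open>monoid\<close> records, which merely bundle a carrier, a binary operation and a
  neutral element; neither the record type nor the isomorphism relation \<open>\<cong>\<close> assumes associativity.
\<close>

definition quadratic_extension :: "('b, 'm) ring_scheme \<Rightarrow> ('k::field \<Rightarrow> 'b) \<Rightarrow> bool" where
  "quadratic_extension K h \<longleftrightarrow>
     field K \<and> h \<in> ring_hom ring_of_type_algebra K \<and> ring.dimension K 2 (range h) (carrier K)"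

definition loop_of_subspace :: "('b, 'm) ring_scheme \<Rightarrow> 'b set \<Rightarrow> ('b \<times> 'b) monoid" where
  "loop_of_subspace K W =
     \<lparr> carrier = W \<times> carrier K,
       monoid.mult = (\<lambda>(a, u) (b, v).
         (a \<oplus>\<^bsub>K\<^esub> b, u \<otimes>\<^bsub>K\<^esub> (\<one>\<^bsub>K\<^esub> \<oplus>\<^bsub>K\<^esub> b) \<oplus>\<^bsub>K\<^esub> v \<otimes>\<^bsub>K\<^esub> (\<one>\<^bsub>K\<^esub> \<ominus>\<^bsub>K\<^esub> a))),
       one = (\<zero>\<^bsub>K\<^esub>, \<zero>\<^bsub>K\<^esub>) \<rparr>"

text \<open>
  The \<open>itself\<close> argument carries the base field, which the type of the loops does not mention.
  \<open>subalgebra\<close> is the library's name for linear subspaces: it only asks for closure under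
  multiplication by scalars.
\<close>

definition quadratic_extension_loops :: "'k::field itself \<Rightarrow> ('b \<times> 'b) monoid set" where
  "quadratic_extension_loops _ =
     {loop_of_subspace K W | (K :: 'b ring) (h :: 'k \<Rightarrow> 'b) W.
        quadratic_extension K h \<and>
        subalgebra (range h) W K \<and> ring.dimension K 1 (range h) W \<and>
        range h \<inter> W = {\<zero>\<^bsub>K\<^esub>}}"

definition matrix_scale :: "'k::field \<Rightarrow> 'k^'n^'m \<Rightarrow> 'k^'n^'m" where
  "matrix_scale c A = (\<chi> i j. c * A $ i $ j)"

definition anisotropic_plane :: "'k::field^2^2 \<Rightarrow> bool" where
  "anisotropic_plane A \<longleftrightarrow>
     (\<forall>a b. (a, b) \<noteq> (0, 0) \<longrightarrow> det (matrix_scale a (mat 1) + matrix_scale b A) \<noteq> 0)"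

definition loop_of_matrix :: "'k::field^2^2 \<Rightarrow> ('k \<times> ('k^2)) monoid" where
  "loop_of_matrix A =
     \<lparr> carrier = UNIV,
       monoid.mult = (\<lambda>(a, u) (b, v).
         (a + b, u v* (mat 1 + matrix_scale b A) + v v* (mat 1 - matrix_scale a A))),
       one = (0, 0) \<rparr>"

definition anisotropic_plane_loops :: "('k::field \<times> ('k^2)) monoid set" where
  "anisotropic_plane_loops = {loop_of_matrix A | A. anisotropic_plane A}"

end

theory Submission
  imports Defs
begin

text \<open>
  Both kinds of loop are built from a plane over \<open>k\<close> on which the elements of a line \<open>k w\<close> act
  linearly. In \<open>Q(W)\<close> with \<open>W = k w\<close> the plane is \<open>K\<close> and \<open>b w\<close> acts as multiplication by \<open>b w\<close>; in
  \<open>Q(A)\<close> the plane consists of the row vectors and \<open>b\<close> acts as \<open>b A\<close>. Hence a \<open>k\<close>-linear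
  bijection from row vectors to \<open>K\<close> that turns \<open>A\<close> into multiplication by \<open>w\<close> induces an
  isomorphism of loops (\<open>matrix_loop_iso_subspace_loop\<close>), and in each direction it remains to find
  such a bijection.

  Given \<open>K\<close> and \<open>W = k w\<close>, the condition that \<open>k\<close> and \<open>W\<close> meet trivially makes \<open>1, w\<close> a basis
  of \<open>K\<close>. Let \<open>A\<close> be the matrix of multiplication by \<open>w\<close> in this basis. Then \<open>det (a I + b A)\<close> is
  the norm of \<open>a + b w\<close>, which vanishes only for \<open>a = b = 0\<close> because \<open>K\<close> has no zero divisors.

  Given \<open>A\<close> with trace \<open>t\<close> and determinant \<open>d\<close>, Cayley-Hamilton says that \<open>k I + k A\<close> is a quotient
  of the ring \<open>k[X] / (X\<^sup>2 - t X + d)\<close>. The norm form of that ring is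
  \<open>(a, b) \<mapsto> det (a I + b A)\<close>, so the ring is a field \<open>K\<close>, and \<open>X\<close> plays the part of \<open>w\<close>.
  The row vectors form a one-dimensional vector space over \<open>K\<close>, so acting on the first basis
  vector identifies \<open>K\<close> with this space and takes multiplication by \<open>X\<close> to the action of \<open>A\<close>.
\<close>

(* Keeps the dollar sign unambiguous: below it always selects vector entries. *)
no_notation fps_nth (infixl \<open>$\<close> 75)

section \<open>Fields containing a copy of k\<close>

locale field_embedding = field K for K :: "('b, 'm) ring_scheme" (structure) +
  fixes h :: "'k::field \<Rightarrow> 'b"
  assumes hom: "h \<in> ring_hom ring_of_type_algebra K"
begin

lemma h_closed [simp, intro]: "h a \<in> carrier K"
  using ring_hom_closed[OF hom] by (simp add: ring_of_type_algebra_def)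

lemma h_add: "h (a + b) = h a \<oplus> h b"
  using ring_hom_add[OF hom, of a b] by (simp add: ring_of_type_algebra_def)

lemma h_mult: "h (a * b) = h a \<otimes> h b"
  using ring_hom_mult[OF hom, of a b] by (simp add: ring_of_type_algebra_def)

lemma h_one [simp]: "h 1 = \<one>"
  using ring_hom_one[OF hom] by (simp add: ring_of_type_algebra_def)

lemma h_zero [simp]: "h 0 = \<zero>"
  using h_add[of 0 0] by (simp add: add.r_cancel_one')

lemma h_minus: "h (- a) = \<ominus> h a"
  using h_add[of "- a" a] by (metis add.left_inverse h_closed h_zero minus_equality)

lemma h_eq_zero_iff [simp]: "h a = \<zero> \<longleftrightarrow> a = 0"
  using h_mult[of a "inverse a"] by (metis h_closed h_one h_zero l_null right_inverse zero_not_one)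

lemma h_eq_iff [simp]: "h a = h b \<longleftrightarrow> a = b"
proof
  assume "h a = h b"
  hence "h (a + - b) = \<zero>" unfolding h_add h_minus by (simp add: r_neg)
  hence "a + - b = 0" unfolding h_eq_zero_iff .
  thus "a = b" by simp
qed simp

lemma subfield_range: "subfield (range h) K"
proof -
  interpret F: field "ring_of_type_algebra :: 'k ring" by (rule field_from_type_algebra)
  interpret ring_hom_ring "ring_of_type_algebra :: 'k ring" K h
    by (rule ring_hom_ringI2) (use hom F.ring_axioms ring_axioms in auto)
  show ?thesis
    using img_is_subfield(2)[OF F.carrier_is_subfield one_not_zero]
    by (simp add: ring_of_type_algebra_def)
qed

lemma line_extension_zero:
  assumes "w \<in> carrier K"
  shows "line_extension (range h) w {\<zero>} = range (\<lambda>b. h b \<otimes> w)"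
  using assms by (auto simp: line_extension_mem_iff)

end

section \<open>Transport of the loop along a module isomorphism\<close>

lemma vec_2_eq_iff: "u = v \<longleftrightarrow> u $ 1 = v $ 1 \<and> u $ 2 = (v $ 2 :: 'a)" for u v :: "'a^2"
  by (simp add: vec_eq_iff forall_2)

lemma vector_matrix_mult_2:
  "(u v* A) $ j = u $ 1 * A $ 1 $ j + u $ 2 * A $ 2 $ j" for A :: "'a::comm_ring_1^2^2"
  by (simp add: vector_matrix_mult_def sum_2 mult.commute)

lemma vector_mult_one_plus_scale:
  "u v* (mat 1 + matrix_scale b A) = u + b *s (u v* A)" for A :: "'k::field^2^2"
  by (simp add: vec_2_eq_iff vector_matrix_mult_2 mat_def matrix_scale_def algebra_simps)

lemma vector_mult_one_minus_scale:
  "u v* (mat 1 - matrix_scale b A) = u + (- b) *s (u v* A)" for A :: "'k::field^2^2"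
  by (simp add: vec_2_eq_iff vector_matrix_mult_2 mat_def matrix_scale_def algebra_simps)

text \<open>
  Being linear, a map that carries the right action of \<open>A\<close> to multiplication by \<open>w\<close> also carries
  the actions of \<open>I + b A\<close> and \<open>I - a A\<close> to multiplication by \<open>1 + b w\<close> and \<open>1 - a w\<close>, which are
  the factors in the two loop products.
\<close>

lemma (in field_embedding) matrix_loop_iso_subspace_loop:
  fixes A :: "'k^2^2"
  assumes w: "w \<in> carrier K" "w \<noteq> \<zero>"
    and bij: "bij_betw \<psi> UNIV (carrier K)"
    and add: "\<And>u v. \<psi> (u + v) = \<psi> u \<oplus> \<psi> v"
    and scale: "\<And>c u. \<psi> (c *s u) = h c \<otimes> \<psi> u"
    and act: "\<And>u. \<psi> (u v* A) = \<psi> u \<otimes> w"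
  shows "(\<lambda>(b, u). (h b \<otimes> w, \<psi> u)) \<in>
           iso (loop_of_matrix A) (loop_of_subspace K (range (\<lambda>b. h b \<otimes> w)))"
proof -
  have \<psi>: "\<psi> u \<in> carrier K" for u using bij by (auto simp: bij_betw_def)
  have plus: "\<psi> (u v* (mat 1 + matrix_scale b A)) = \<psi> u \<otimes> (\<one> \<oplus> h b \<otimes> w)" for u b
    using w \<psi> unfolding vector_mult_one_plus_scale add scale act
    by (simp add: r_distr m_lcomm)
  have minus: "\<psi> (u v* (mat 1 - matrix_scale b A)) = \<psi> u \<otimes> (\<one> \<ominus> h b \<otimes> w)" for u b
    using w \<psi> unfolding vector_mult_one_minus_scale add scale act
    by (simp add: r_distr m_lcomm h_minus a_minus_def l_minus r_minus)
  have inj: "h a \<otimes> w = h b \<otimes> w \<longleftrightarrow> a = b" for a b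
    using w m_rcancel[of w "h a" "h b"] by simp
  have "bij_betw (\<lambda>(b, u). (h b \<otimes> w, \<psi> u)) (UNIV \<times> UNIV) (range (\<lambda>b. h b \<otimes> w) \<times> carrier K)"
    by (rule bij_betw_map_prod[unfolded map_prod_def]) (use bij inj in \<open>auto simp: bij_betw_def inj_on_def\<close>)
  thus ?thesis
    using w \<psi>
    by (auto simp: iso_def hom_def loop_of_matrix_def loop_of_subspace_def h_add l_distr add plus minus)
qed

text \<open>
  Closure of the source is what makes the product of two preimages the preimage of the product.
\<close>

lemma is_iso_sym_of_closed:
  assumes "f \<in> iso G H"
    and closed: "\<And>x y. x \<in> carrier G \<Longrightarrow> y \<in> carrier G \<Longrightarrow> x \<otimes>\<^bsub>G\<^esub> y \<in> carrier G"
  shows "H \<cong> G"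
proof (rule is_isoI)
  let ?g = "inv_into (carrier G) f"
  from assms have f: "f \<in> hom G H" "bij_betw f (carrier G) (carrier H)" by (auto simp: iso_def)
  have "?g (x \<otimes>\<^bsub>H\<^esub> y) = ?g x \<otimes>\<^bsub>G\<^esub> ?g y" if "x \<in> carrier H" "y \<in> carrier H" for x y
  proof (rule inv_into_f_eq)
    have g: "?g x \<in> carrier G" "?g y \<in> carrier G" "f (?g x) = x" "f (?g y) = y"
      using that f(2) by (auto simp: bij_betw_def inv_into_into f_inv_into_f)
    show "f (?g x \<otimes>\<^bsub>G\<^esub> ?g y) = x \<otimes>\<^bsub>H\<^esub> y" using hom_mult[OF f(1) g(1,2)] g(3,4) by simp
    show "?g x \<otimes>\<^bsub>G\<^esub> ?g y \<in> carrier G" using closed g by blast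
  qed (use f(2) in \<open>auto simp: bij_betw_def\<close>)
  thus "?g \<in> iso H G"
    using bij_betw_inv_into[OF f(2)] by (auto simp: iso_def hom_def bij_betw_def)
qed

text \<open>
  Expanding \<open>det (a I + b A)\<close> exhibits it as the norm form of \<open>k[X] / (X\<^sup>2 - t X + d)\<close>, where \<open>t\<close> and
  \<open>d\<close> are the trace and the determinant of \<open>A\<close>.
\<close>

lemma anisotropic_plane_iff:
  "anisotropic_plane A \<longleftrightarrow>
     (\<forall>a b. a * a + a * b * (A $ 1 $ 1 + A $ 2 $ 2) + b * b * det A = 0 \<longrightarrow> a = 0 \<and> b = 0)"
  by (auto simp: anisotropic_plane_def det_2 matrix_scale_def mat_def algebra_simps)

section \<open>From a quadratic extension to a matrix\<close>

definition (in field_embedding) combination :: "'b \<Rightarrow> 'k^2 \<Rightarrow> 'b" where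
  "combination w u = h (u $ 1) \<oplus> h (u $ 2) \<otimes> w"

lemma (in field_embedding) combination_closed [simp]:
  "w \<in> carrier K \<Longrightarrow> combination w u \<in> carrier K"
  by (simp add: combination_def)

lemma (in field_embedding) combination_add:
  "w \<in> carrier K \<Longrightarrow> combination w (u + v) = combination w u \<oplus> combination w v"
  by (simp add: combination_def h_add l_distr a_ac)

lemma (in field_embedding) combination_scale:
  "w \<in> carrier K \<Longrightarrow> combination w (c *s u) = h c \<otimes> combination w u"
  by (simp add: combination_def h_mult r_distr m_assoc)

text \<open>
  The pair \<open>1, w\<close> is independent because \<open>1\<close> lies in \<open>k\<close> and hence not in \<open>k w\<close>. Two independent
  vectors span a plane, which gives surjectivity; a linear relation between \<open>1\<close> and \<open>w\<close> would produce a
  nonzero element common to \<open>k\<close> and \<open>k w\<close>, which gives injectivity.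
\<close>

lemma (in field_embedding) combination_bij:
  assumes dim: "dimension 2 (range h) (carrier K)"
    and w: "w \<in> carrier K" "w \<noteq> \<zero>"
    and disj: "range h \<inter> range (\<lambda>b. h b \<otimes> w) = {\<zero>}"
  shows "bij_betw (combination w) UNIV (carrier K)"
proof -
  have Span_w: "Span (range h) [w] = range (\<lambda>b. h b \<otimes> w)"
    using w by (simp add: line_extension_zero)
  have "\<one> \<in> range h" using rangeI[of h 1] by simp
  hence "\<one> \<notin> Span (range h) [w]"
    using disj one_not_zero unfolding Span_w by blast
  hence "independent (range h) [\<one>, w]"
    using w by (intro li_Cons) auto
  hence Span: "Span (range h) [\<one>, w] = carrier K"
    using independent_length_eq_dimension[OF subfield_range dim, of "[\<one>, w]"] w by simp
  have "\<exists>u. x = combination w u" if "x \<in> carrier K" for x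
  proof -
    have "x \<in> line_extension (range h) \<one> (range (\<lambda>b. h b \<otimes> w))"
      using that w Span by (simp add: line_extension_zero)
    then obtain a b where "x = h a \<otimes> \<one> \<oplus> h b \<otimes> w"
      by (auto simp: line_extension_mem_iff)
    thus ?thesis by (intro exI[of _ "vector [a, b]"]) (simp add: combination_def)
  qed
  moreover have "u = 0" if "combination w u = \<zero>" for u
  proof -
    have "h (u $ 1) = h (- u $ 2) \<otimes> w"
      using that w by (simp add: combination_def h_minus l_minus sum_zero_eq_neg)
    hence "h (u $ 1) \<in> range h \<inter> range (\<lambda>b. h b \<otimes> w)" by blast
    hence "h (u $ 1) = \<zero>" unfolding disj by simp
    moreover from this have "h (u $ 2) = \<zero>"
      using that w integral[of "h (u $ 2)" w] by (simp add: combination_def)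
    ultimately show "u = 0" by (simp add: vec_2_eq_iff)
  qed
  hence "inj (combination w)"
    by (intro injI) (metis add.r_cancel_one combination_add combination_closed diff_add_cancel eq_iff_diff_eq_0 w(1))
  ultimately show ?thesis using w by (auto simp: bij_betw_def)
qed

lemma (in field_embedding) subspace_loop_iso_matrix_loop:
  assumes dim: "dimension 2 (range h) (carrier K)"
    and dimW: "dimension 1 (range h) W"
    and disj: "range h \<inter> W = {\<zero>}"
  shows "\<exists>A. anisotropic_plane (A :: 'k^2^2) \<and> loop_of_subspace K W \<cong> loop_of_matrix A"
proof -
  obtain w E where "w \<in> carrier K" "dimension 0 (range h) E" "w \<notin> E" "W = line_extension (range h) w E"
    using dimension_backwards[OF subfield_range, of 0 W] dimW by auto
  hence w: "w \<in> carrier K" "w \<noteq> \<zero>" and W: "W = range (\<lambda>b. h b \<otimes> w)"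
    using dimension_zero[OF subfield_range, of E] by (auto simp: line_extension_zero)
  note bij = combination_bij[OF dim w disj[unfolded W]]
  note add = combination_add[OF w(1)] and scale = combination_scale[OF w(1)]
  obtain s :: "'k^2" where s: "w \<otimes> w = combination w s"
    using bij w by (metis bij_betw_imp_surj_on imageE m_closed)
  define q p where "q = s $ 1" and "p = s $ 2"
  have ww: "w \<otimes> w = h q \<oplus> h p \<otimes> w" using s by (simp add: combination_def q_def p_def)
  \<comment> \<open>Row \<open>i\<close> holds the coordinates of the \<open>i\<close>-th basis vector times \<open>w\<close>: first \<open>1 w\<close>, then \<open>w w\<close>.\<close>
  define A :: "'k^2^2" where "A = vector [vector [0, 1], vector [q, p]]"
  have act: "combination w (u v* A) = combination w u \<otimes> w" for u
  proof -
    have "combination w u \<otimes> w = h (u $ 1) \<otimes> w \<oplus> h (u $ 2) \<otimes> (w \<otimes> w)"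
      using w by (simp add: combination_def l_distr m_assoc)
    also have "\<dots> = combination w (u v* A)"
      unfolding ww using w
      by (simp add: combination_def A_def vector_matrix_mult_2 h_add h_mult l_distr r_distr m_assoc a_ac)
    finally show ?thesis ..
  qed
  have "anisotropic_plane A"
    unfolding anisotropic_plane_iff
  proof (intro allI impI)
    fix a b :: 'k
    assume "a * a + a * b * (A $ 1 $ 1 + A $ 2 $ 2) + b * b * det A = 0"
    hence norm: "a * (a + b * p) - b * (b * q) = 0"
      by (simp add: A_def det_2 algebra_simps)
    \<comment> \<open>The other root of the minimal polynomial \<open>X\<^sup>2 - p X - q\<close> of \<open>w\<close> is \<open>p - w\<close>, so this is the
      conjugate \<open>a + b (p - w)\<close> of \<open>a + b w\<close>. Their product is the norm, assumed to be zero.\<close>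
    define v :: "'k^2" where "v = vector [a + b * p, - b]"
    have "combination w (vector [a, b]) \<otimes> combination w v = h a \<otimes> combination w v \<oplus> h b \<otimes> combination w (v v* A)"
      unfolding act using w by (simp add: combination_def[of w "vector [a, b]"] l_distr r_distr m_ac)
    also have "\<dots> = combination w (a *s v + b *s (v v* A))"
      by (simp only: add scale)
    also have "a *s v + b *s (v v* A) = 0"
      using norm by (simp add: vec_2_eq_iff vector_matrix_mult_2 v_def A_def algebra_simps)
    also have "combination w 0 = \<zero>" using w by (simp add: combination_def)
    finally have "combination w (vector [a, b]) = \<zero> \<or> combination w v = \<zero>"
      using integral bij by (meson bij_betwE UNIV_I)
    moreover have "u = 0" if "combination w u = \<zero>" for u
      using injD[OF bij_betw_imp_inj_on[OF bij], of u 0] that w by (simp add: combination_def)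
    ultimately show "a = 0 \<and> b = 0" by (fastforce simp: v_def vec_2_eq_iff)
  qed
  moreover have "loop_of_subspace K W \<cong> loop_of_matrix A"
    unfolding W
    by (rule is_iso_sym_of_closed[OF matrix_loop_iso_subspace_loop[OF w bij add scale act]])
       (simp add: loop_of_matrix_def)
  ultimately show ?thesis by blast
qed

section \<open>From a matrix to a quadratic extension\<close>

text \<open>
  This is \<open>k[X] / (X\<^sup>2 - t X + d)\<close>, with \<open>(a, b)\<close> standing for the class of \<open>a + b X\<close>.
\<close>

definition quadratic_algebra :: "'k::field \<Rightarrow> 'k \<Rightarrow> ('k \<times> 'k) ring" where
  "quadratic_algebra t d =
     \<lparr> carrier = UNIV,
       monoid.mult = (\<lambda>(a, b) (a', b'). (a * a' - d * b * b', a * b' + b * a' + t * b * b')),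
       one = (1, 0),
       ring.zero = (0, 0),
       add = (\<lambda>(a, b) (a', b'). (a + a', b + b')) \<rparr>"

text \<open>
  The hypothesis says that only \<open>0\<close> has norm \<open>0\<close>. So every other element is inverted by its
  conjugate \<open>a + b (t - X)\<close> divided by its norm.
\<close>

lemma field_quadratic_algebra:
  fixes t d :: "'k::field"
  assumes norm: "\<And>a b. a * a + a * b * t + b * b * d = 0 \<Longrightarrow> a = 0 \<and> b = 0"
  shows "field (quadratic_algebra t d)"
proof -
  interpret cring "quadratic_algebra t d"
  proof (rule cringI)
    show "abelian_group (quadratic_algebra t d)"
    proof (rule abelian_groupI)
      fix x assume "x \<in> carrier (quadratic_algebra t d)"
      show "\<exists>y\<in>carrier (quadratic_algebra t d). y \<oplus>\<^bsub>quadratic_algebra t d\<^esub> x = \<zero>\<^bsub>quadratic_algebra t d\<^esub>"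
        by (rule bexI[of _ "(- fst x, - snd x)"]) (auto simp: quadratic_algebra_def split: prod.split)
    qed (auto simp: quadratic_algebra_def)
    show "comm_monoid (quadratic_algebra t d)"
      by (rule comm_monoidI) (auto simp: quadratic_algebra_def algebra_simps)
  qed (auto simp: quadratic_algebra_def algebra_simps)
  show ?thesis
  proof (rule cring_fieldI2)
    fix x assume "x \<in> carrier (quadratic_algebra t d)" "x \<noteq> \<zero>\<^bsub>quadratic_algebra t d\<^esub>"
    then obtain a b where x: "x = (a, b)" "(a, b) \<noteq> (0, 0)"
      by (cases x) (auto simp: quadratic_algebra_def)
    define N where "N = a * a + a * b * t + b * b * d"
    have N: "N \<noteq> 0" using norm[of a b] x(2) unfolding N_def by blast
    define c where "c = inverse N"
    have "(a * a + a * b * t + b * b * d) * c = 1"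
      using N by (simp add: c_def flip: N_def)
    hence "x \<otimes>\<^bsub>quadratic_algebra t d\<^esub> ((a + b * t) * c, - b * c) = \<one>\<^bsub>quadratic_algebra t d\<^esub>"
      by (simp add: quadratic_algebra_def x algebra_simps)
    thus "\<exists>y\<in>carrier (quadratic_algebra t d). x \<otimes>\<^bsub>quadratic_algebra t d\<^esub> y = \<one>\<^bsub>quadratic_algebra t d\<^esub>"
      by (auto simp: quadratic_algebra_def)
  qed (simp add: quadratic_algebra_def)
qed

lemma field_embedding_quadratic_algebra:
  fixes t d :: "'k::field"
  assumes "\<And>a b. a * a + a * b * t + b * b * d = 0 \<Longrightarrow> a = 0 \<and> b = 0"
  shows "field_embedding (quadratic_algebra t d) (\<lambda>a. (a, 0))"
proof -
  interpret field "quadratic_algebra t d" using field_quadratic_algebra[OF assms] .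
  show ?thesis
    by unfold_locales (auto simp: ring_hom_def ring_of_type_algebra_def quadratic_algebra_def)
qed

text \<open>
  The subspace is the line spanned by \<open>X\<close> in the quadratic algebra of the characteristic
  polynomial of \<open>A\<close>.
\<close>

lemma matrix_loop_iso_quadratic_extension_loop:
  fixes A :: "'k::field^2^2"
  assumes A: "anisotropic_plane A"
  shows "\<exists>L \<in> (quadratic_extension_loops TYPE('k) :: (('k \<times> 'k) \<times> ('k \<times> 'k)) monoid set).
           loop_of_matrix A \<cong> L"
proof -
  define K where "K = quadratic_algebra (A $ 1 $ 1 + A $ 2 $ 2) (det A)"
  define h :: "'k \<Rightarrow> 'k \<times> 'k" where "h = (\<lambda>a. (a, 0))"
  define w :: "'k \<times> 'k" where "w = (0, 1)"
  define W :: "('k \<times> 'k) set" where "W = range (\<lambda>b. h b \<otimes>\<^bsub>K\<^esub> w)"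
  note K_simps = K_def quadratic_algebra_def h_def w_def
  interpret field_embedding K h
    unfolding K_def h_def by (rule field_embedding_quadratic_algebra) (use A in \<open>unfold anisotropic_plane_iff, blast\<close>)
  have w: "w \<in> carrier K" "w \<noteq> \<zero>\<^bsub>K\<^esub>" by (auto simp: K_simps)
  have W: "W = range (Pair 0)" by (auto simp: W_def K_simps)
  have dimW: "dimension 1 (range h) W"
    using Suc_dim[OF w(1) _ zero_dim, of "range h"] w by (simp add: W_def line_extension_zero)
  have "\<one>\<^bsub>K\<^esub> \<notin> W" by (auto simp: W K_simps)
  moreover have "line_extension (range h) \<one>\<^bsub>K\<^esub> W = carrier K"
    unfolding set_eq_iff line_extension_mem_iff by (auto simp: W K_simps)
  ultimately have "dimension 2 (range h) (carrier K)"
    using Suc_dim[OF one_closed _ dimW] by (simp add: numeral_2_eq_2)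
  hence "quadratic_extension K h"
    using hom field_axioms by (simp add: quadratic_extension_def)
  moreover have "subalgebra (range h) W K"
    unfolding subalgebra_def subalgebra_axioms_def
  proof
    show "subgroup W (add_monoid K)"
      using line_extension_is_subgroup[OF subfield_range normal_imp_subgroup[OF add.one_is_normal] w(1)]
      by (simp add: W_def line_extension_zero w)
  qed (auto simp: W K_simps)
  moreover have "range h \<inter> W = {\<zero>\<^bsub>K\<^esub>}" by (auto simp: W K_simps)
  ultimately have "loop_of_subspace K W \<in> quadratic_extension_loops TYPE('k)"
    using dimW unfolding quadratic_extension_loops_def by blast
  moreover have "loop_of_matrix A \<cong> loop_of_subspace K W"
  proof -
    \<comment> \<open>Otherwise \<open>A - A\<^sub>1\<^sub>1 I\<close> would have a zero first row.\<close>
    have A12: "A $ 1 $ 2 \<noteq> 0"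
      using A[unfolded anisotropic_plane_def, rule_format, of "- A $ 1 $ 1" 1]
      by (auto simp: det_2 matrix_scale_def mat_def)
    \<comment> \<open>The inverse of the map that sends \<open>(x, y)\<close> to the first row of \<open>x I + y A\<close>.\<close>
    define \<psi> where "\<psi> = (\<lambda>u :: 'k^2. (u $ 1 - u $ 2 * A $ 1 $ 1 / A $ 1 $ 2, u $ 2 / A $ 1 $ 2))"
    have "bij \<psi>"
      by (rule o_bij[of "\<lambda>(x, y). vector [x + y * A $ 1 $ 1, y * A $ 1 $ 2]"])
         (use A12 in \<open>auto simp: fun_eq_iff \<psi>_def vec_2_eq_iff\<close>)
    hence bij: "bij_betw \<psi> UNIV (carrier K)" by (simp add: K_simps)
    show ?thesis
      unfolding W_def
    proof (rule is_isoI[OF matrix_loop_iso_subspace_loop[OF w bij]])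
      show "\<psi> (u + v) = \<psi> u \<oplus>\<^bsub>K\<^esub> \<psi> v" for u v
        by (simp add: \<psi>_def K_simps algebra_simps add_divide_distrib)
      show "\<psi> (c *s u) = h c \<otimes>\<^bsub>K\<^esub> \<psi> u" for c u
        by (simp add: \<psi>_def K_simps algebra_simps)
      show "\<psi> (u v* A) = \<psi> u \<otimes>\<^bsub>K\<^esub> w" for u
        using A12 by (simp add: \<psi>_def K_simps vector_matrix_mult_2 det_2 field_simps)
    qed
  qed
  ultimately show ?thesis by blast
qed

theorem proposition4p3:
  shows "(\<forall>L \<in> (quadratic_extension_loops TYPE('k::field) :: ('b \<times> 'b) monoid set).
            \<exists>M \<in> (anisotropic_plane_loops :: ('k \<times> ('k^2)) monoid set). L \<cong> M) \<and>
         (\<forall>M \<in> (anisotropic_plane_loops :: ('k \<times> ('k^2)) monoid set).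
            \<exists>L \<in> (quadratic_extension_loops TYPE('k) :: (('k \<times> 'k) \<times> ('k \<times> 'k)) monoid set). M \<cong> L)"
proof (intro conjI ballI)
  fix L :: "('b \<times> 'b) monoid"
  assume "L \<in> quadratic_extension_loops TYPE('k)"
  then obtain K :: "'b ring" and h :: "'k \<Rightarrow> 'b" and W
    where L: "L = loop_of_subspace K W" and "quadratic_extension K h"
      and W: "ring.dimension K 1 (range h) W" "range h \<inter> W = {\<zero>\<^bsub>K\<^esub>}"
    unfolding quadratic_extension_loops_def by blast
  hence K: "field K" "h \<in> ring_hom ring_of_type_algebra K" "ring.dimension K 2 (range h) (carrier K)"
    by (auto simp: quadratic_extension_def)
  interpret field_embedding K h
    using K by (simp add: field_embedding_def field_embedding_axioms_def)
  show "\<exists>M \<in> (anisotropic_plane_loops :: ('k \<times> ('k^2)) monoid set). L \<cong> M"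
    using subspace_loop_iso_matrix_loop[OF K(3) W] L unfolding anisotropic_plane_loops_def by blast
next
  fix M :: "('k \<times> ('k^2)) monoid"
  assume "M \<in> anisotropic_plane_loops"
  thus "\<exists>L \<in> (quadratic_extension_loops TYPE('k) :: (('k \<times> 'k) \<times> ('k \<times> 'k)) monoid set). M \<cong> L"
    unfolding anisotropic_plane_loops_def using matrix_loop_iso_quadratic_extension_loop by blast
qed

end
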